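(* A $p$-local finite group $(S,\mathcal F,\mathcal L)$ is nilpotent if and only if one of the following four conditions is satisfied: (1) two elements $a,b\in S$ are $\mathcal F$-conjugate if and only if they are $S$-conjugate; (2) for some integer $n>1$, two $n$-tuples of pairwise commuting elements of $S$ are $\mathcal F$-conjugate if and only if they are $S$-conjugate; (3) for every subgroup $P\le S$, $\mathrm{Aut}_{\mathcal F}(P)$ is a $p$-group; (4) for every $\mathcal F$-centric subgroup $P\le S$, $\mathrm{Aut}_{\mathcal F}(P)$ is a $p$-group.
   Context: Elements $a,b\in S$ are $\mathcal F$-conjugate if there is $\phi\in\mathrm{Hom}_{\mathcal F}(\langle a\rangle,S)$ with $\phi(a)=b$, and $S$-conjugate if $b=sas^{-1}$ for some $s\in S$. Two $n$-tuples $(a_1,\dots,a_n)$, $(b_1,\dots,b_n)$ of commuting elements of $S$ are $\mathcal F$-conjugate if there is $\phi\in\mathrm{Hom}_{\mathcal F}(\langle a_1,\dots,a_n\rangle,S)$ with $\phi(a_i)=b_i$ for all $i$, and $S$-conjugate if there is $s\in S$ with $sa_is^{-1}=b_i$ for all $i$. Let $p$ be a prime and $S$ a finite $p$-group. For $P,Q\le S$, $\mathrm{Hom}_S(P,Q)$ is the set of maps $c_g\colon x\mapsto gxg^{-1}$ with $g\in S$, $gPg^{-1}\le Q$, and $\mathrm{Aut}_S(P)=\mathrm{Hom}_S(P,P)$. A fusion system $\mathcal F$ over $S$ is a category whose objects are the subgroups of $S$, with $\mathrm{Hom}_S(P,Q)\subseteq\mathrm{Hom}_{\mathcal F}(P,Q)\subseteq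 \mathrm{Inj}(P,Q)$, such that every morphism factors as an $\mathcal F$-isomorphism followed by an inclusion; $\mathrm{Aut}_{\mathcal F}(P)$ is the group of $\mathcal F$-automorphisms of $P$. Subgroups are $\mathcal F$-conjugate if they are isomorphic in $\mathcal F$. $P$ is fully centralized (resp. fully normalized) if $|C_S(P)|\ge |C_S(P')|$ (resp. $|N_S(P)|\ge|N_S(P')|$) for all $P'$ $\mathcal F$-conjugate to $P$. $\mathcal F$ is saturated if (I) every fully normalized $P$ is fully centralized and $\mathrm{Aut}_S(P)$ is a Sylow $p$-subgroup of $\mathrm{Aut}_{\mathcal F}(P)$, and (II) whenever $\phi\in\mathrm{Hom}_{\mathcal F}(P,S)$ with $\phi(P)$ fully centralized, $\phi$ extends to a morphism in $\mathcal F$ defined on $N_\phi=\{g\in N_S(P):\phi c_g\phi^{-1}\in \mathrm{Aut}_S(\phi(P))\}$. $P$ is $\mathcal F$-centric if $C_S(P')\le P'$ for all $P'$ $\mathcal F$-conjugate to $P$; $\mathcal F^c$ is the full subcategory on these. A centric linking system associated to $\mathcal F$ is a category $\mathcal L$ with objects the $\mathcal F$-centric subgroups, a functor $\pi\colon\mathcal L\to\mathcal F^c$ which is the identity on objects, and monomorphisms $\delta_P\colon P\to\mathrm{Aut}_{\mathcal L}(P)$, such that (A) $Z(P)$ (via $\delta_P$) acts freely on $\mathrm{Mor}_{\mathcal L}(P,Q)$ by composition and $\pi$ induces a bijection $\mathrm{Mor}_{\mathcal L}(P,Q)/Z(P)\to\mathrm{Hom}_{\mathcal F}(P,Q)$;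 (B) $\pi(\delta_P(g))=c_g$ for $g\in P$; (C) $f\circ\delta_P(g)=\delta_Q(\pi(f)(g))\circ f$ for $f\in\mathrm{Mor}_{\mathcal L}(P,Q)$, $g\in P$. A $p$-local finite group is a triple $(S,\mathcal F,\mathcal L)$ with $\mathcal F$ a saturated fusion system over $S$ and $\mathcal L$ an associated centric linking system. $(S,\mathcal F,\mathcal L)$ is called nilpotent if $\mathcal F=\mathcal F_S(S)$, the fusion system with $\mathrm{Hom}_{\mathcal F_S(S)}(P,Q)=\mathrm{Hom}_S(P,Q)$. *)

theory Defs
  imports "HOL-Algebra.Algebra" "HOL-Library.FuncSet"
begin

definition conjm :: "('a, 'b) monoid_scheme \<Rightarrow> 'a \<Rightarrow> 'a \<Rightarrow> 'a" where
  "conjm S g = (\<lambda>x. g \<otimes>\<^bsub>S\<^esub> x \<otimes>\<^bsub>S\<^esub> inv\<^bsub>S\<^esub> g)"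

definition centS :: "('a, 'b) monoid_scheme \<Rightarrow> 'a set \<Rightarrow> 'a set" where
  "centS S P = {s \<in> carrier S. \<forall>x\<in>P. s \<otimes>\<^bsub>S\<^esub> x = x \<otimes>\<^bsub>S\<^esub> s}"

definition normS :: "('a, 'b) monoid_scheme \<Rightarrow> 'a set \<Rightarrow> 'a set" where
  "normS S P = {s \<in> carrier S. conjm S s ` P = P}"

definition centre_of :: "('a, 'b) monoid_scheme \<Rightarrow> 'a set \<Rightarrow> 'a set" where
  "centre_of S P = {z \<in> P. \<forall>x\<in>P. z \<otimes>\<^bsub>S\<^esub> x = x \<otimes>\<^bsub>S\<^esub> z}"

definition InjS :: "('a, 'b) monoid_scheme \<Rightarrow> 'a set \<Rightarrow> 'a set \<Rightarrow> ('a \<Rightarrow> 'a) set" where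
  "InjS S P Q = {\<phi> \<in> extensional P. (\<forall>x\<in>P. \<phi> x \<in> Q)
      \<and> (\<forall>x\<in>P. \<forall>y\<in>P. \<phi> (x \<otimes>\<^bsub>S\<^esub> y) = \<phi> x \<otimes>\<^bsub>S\<^esub> \<phi> y) \<and> inj_on \<phi> P}"

definition HomS :: "('a, 'b) monoid_scheme \<Rightarrow> 'a set \<Rightarrow> 'a set \<Rightarrow> ('a \<Rightarrow> 'a) set" where
  "HomS S P Q = {restrict (conjm S g) P | g. g \<in> carrier S \<and> conjm S g ` P \<subseteq> Q}"

text \<open>A fusion system over S is given by F P Q = Hom_F(P,Q) for subgroups P, Q of S.\<close>

definition F_iso :: "('a, 'b) monoid_scheme \<Rightarrow> ('a set \<Rightarrow> 'a set \<Rightarrow> ('a \<Rightarrow> 'a) set)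
    \<Rightarrow> 'a set \<Rightarrow> 'a set \<Rightarrow> ('a \<Rightarrow> 'a) \<Rightarrow> bool" where
  "F_iso S F P Q \<phi> \<longleftrightarrow> \<phi> \<in> F P Q \<and> (\<exists>\<psi>\<in>F Q P.
      compose P \<psi> \<phi> = restrict id P \<and> compose Q \<phi> \<psi> = restrict id Q)"

definition fusion_system :: "('a, 'b) monoid_scheme \<Rightarrow> ('a set \<Rightarrow> 'a set \<Rightarrow> ('a \<Rightarrow> 'a) set) \<Rightarrow> bool" where
  "fusion_system S F \<longleftrightarrow>
     (\<forall>P Q. subgroup P S \<and> subgroup Q S \<longrightarrow> HomS S P Q \<subseteq> F P Q \<and> F P Q \<subseteq> InjS S P Q)
   \<and> (\<forall>P Q R \<phi> \<psi>. subgroup P S \<and> subgroup Q S \<and> subgroup R S \<and> \<phi> \<in> F P Q \<and> \<psi> \<in> F Q R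
        \<longrightarrow> compose P \<psi> \<phi> \<in> F P R)
   \<and> (\<forall>P Q \<phi>. subgroup P S \<and> subgroup Q S \<and> \<phi> \<in> F P Q \<longrightarrow>
        F_iso S F P (\<phi> ` P) \<phi> \<and> restrict id (\<phi> ` P) \<in> F (\<phi> ` P) Q
        \<and> compose P (restrict id (\<phi> ` P)) \<phi> = \<phi>)"

definition F_conj_sub :: "('a, 'b) monoid_scheme \<Rightarrow> ('a set \<Rightarrow> 'a set \<Rightarrow> ('a \<Rightarrow> 'a) set)
    \<Rightarrow> 'a set \<Rightarrow> 'a set \<Rightarrow> bool" where
  "F_conj_sub S F P Q \<longleftrightarrow> subgroup P S \<and> subgroup Q S \<and> (\<exists>\<phi>. F_iso S F P Q \<phi>)"

definition fully_centralized where
  "fully_centralized S F P \<longleftrightarrow> subgroup P S \<and>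
     (\<forall>P'. F_conj_sub S F P P' \<longrightarrow> card (centS S P') \<le> card (centS S P))"

definition fully_normalized where
  "fully_normalized S F P \<longleftrightarrow> subgroup P S \<and>
     (\<forall>P'. F_conj_sub S F P P' \<longrightarrow> card (normS S P') \<le> card (normS S P))"

definition autF :: "('a, 'b) monoid_scheme \<Rightarrow> ('a set \<Rightarrow> 'a set \<Rightarrow> ('a \<Rightarrow> 'a) set) \<Rightarrow> 'a set
    \<Rightarrow> ('a \<Rightarrow> 'a) monoid" where
  "autF S F P = \<lparr>carrier = F P P, monoid.mult = (\<lambda>\<psi> \<phi>. compose P \<psi> \<phi>), one = restrict id P\<rparr>"

definition p_group :: "nat \<Rightarrow> ('c, 'd) monoid_scheme \<Rightarrow> bool" where
  "p_group p G \<longleftrightarrow> group G \<and> finite (carrier G) \<and> (\<exists>k. card (carrier G) = p ^ k)"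

definition sylow_sub :: "nat \<Rightarrow> ('c, 'd) monoid_scheme \<Rightarrow> 'c set \<Rightarrow> bool" where
  "sylow_sub p G H \<longleftrightarrow> subgroup H G \<and> (\<exists>k. card H = p ^ k) \<and> \<not> p dvd (order G div card H)"

definition N_phi :: "('a, 'b) monoid_scheme \<Rightarrow> 'a set \<Rightarrow> ('a \<Rightarrow> 'a) \<Rightarrow> 'a set" where
  "N_phi S P \<phi> = {g \<in> normS S P.
     restrict (\<lambda>y. \<phi> (conjm S g (inv_into P \<phi> y))) (\<phi> ` P) \<in> HomS S (\<phi> ` P) (\<phi> ` P)}"

definition saturated :: "nat \<Rightarrow> ('a, 'b) monoid_scheme \<Rightarrow> ('a set \<Rightarrow> 'a set \<Rightarrow> ('a \<Rightarrow> 'a) set) \<Rightarrow> bool" where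
  "saturated p S F \<longleftrightarrow> fusion_system S F
   \<and> (\<forall>P. fully_normalized S F P \<longrightarrow>
          fully_centralized S F P \<and> sylow_sub p (autF S F P) (HomS S P P))
   \<and> (\<forall>P \<phi>. subgroup P S \<and> \<phi> \<in> F P (carrier S) \<and> fully_centralized S F (\<phi> ` P) \<longrightarrow>
          (\<exists>\<psi>\<in>F (N_phi S P \<phi>) (carrier S). \<forall>x\<in>P. \<psi> x = \<phi> x))"

definition F_centric where
  "F_centric S F P \<longleftrightarrow> subgroup P S \<and> (\<forall>P'. F_conj_sub S F P P' \<longrightarrow> centS S P' \<subseteq> P')"

record ('a, 'm) lsys =
  Mor :: "'a set \<Rightarrow> 'a set \<Rightarrow> 'm set"
  lcomp :: "'m \<Rightarrow> 'm \<Rightarrow> 'm"   (* lcomp g f = g \<circ> f *)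
  lid :: "'a set \<Rightarrow> 'm"
  proj :: "'m \<Rightarrow> ('a \<Rightarrow> 'a)"
  ldelta :: "'a set \<Rightarrow> 'a \<Rightarrow> 'm"

definition AutL :: "('a, 'm, 'e) lsys_scheme \<Rightarrow> 'a set \<Rightarrow> 'm set" where
  "AutL L P = {f \<in> Mor L P P. \<exists>g\<in>Mor L P P. lcomp L g f = lid L P \<and> lcomp L f g = lid L P}"

definition linking_system :: "('a, 'b) monoid_scheme \<Rightarrow> ('a set \<Rightarrow> 'a set \<Rightarrow> ('a \<Rightarrow> 'a) set)
    \<Rightarrow> ('a, 'm, 'e) lsys_scheme \<Rightarrow> bool" where
  "linking_system S F L \<longleftrightarrow>
   \<comment> \<open>L is a category on the F-centric subgroups (with disjoint hom-sets)\<close>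
     (\<forall>P Q P' Q'. F_centric S F P \<and> F_centric S F Q \<and> F_centric S F P' \<and> F_centric S F Q'
        \<and> (P, Q) \<noteq> (P', Q') \<longrightarrow> Mor L P Q \<inter> Mor L P' Q' = {})
   \<and> (\<forall>P Q R f g. F_centric S F P \<and> F_centric S F Q \<and> F_centric S F R
        \<and> f \<in> Mor L P Q \<and> g \<in> Mor L Q R \<longrightarrow> lcomp L g f \<in> Mor L P R)
   \<and> (\<forall>P Q R T f g h. F_centric S F P \<and> F_centric S F Q \<and> F_centric S F R \<and> F_centric S F T
        \<and> f \<in> Mor L P Q \<and> g \<in> Mor L Q R \<and> h \<in> Mor L R T
        \<longrightarrow> lcomp L h (lcomp L g f) = lcomp L (lcomp L h g) f)
   \<and> (\<forall>P Q f. F_centric S F P \<and> F_centric S F Q \<and> f \<in> Mor L P Q \<longrightarrow>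
        lid L P \<in> Mor L P P \<and> lcomp L f (lid L P) = f \<and> lcomp L (lid L Q) f = f)
   \<comment> \<open>pi is a functor L \<rightarrow> F^c which is the identity on objects\<close>
   \<and> (\<forall>P Q f. F_centric S F P \<and> F_centric S F Q \<and> f \<in> Mor L P Q \<longrightarrow> proj L f \<in> F P Q)
   \<and> (\<forall>P Q R f g. F_centric S F P \<and> F_centric S F Q \<and> F_centric S F R
        \<and> f \<in> Mor L P Q \<and> g \<in> Mor L Q R \<longrightarrow>
        proj L (lcomp L g f) = compose P (proj L g) (proj L f))
   \<and> (\<forall>P. F_centric S F P \<longrightarrow> proj L (lid L P) = restrict id P)
   \<comment> \<open>delta_P : P \<rightarrow> Aut_L(P) is an injective group homomorphism\<close>
   \<and> (\<forall>P. F_centric S F P \<longrightarrow>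
        (\<forall>g\<in>P. ldelta L P g \<in> AutL L P)
      \<and> (\<forall>g\<in>P. \<forall>h\<in>P. ldelta L P (g \<otimes>\<^bsub>S\<^esub> h) = lcomp L (ldelta L P g) (ldelta L P h))
      \<and> inj_on (ldelta L P) P)
   \<comment> \<open>(A)\<close>
   \<and> (\<forall>P Q. F_centric S F P \<and> F_centric S F Q \<longrightarrow>
        (\<forall>f\<in>Mor L P Q. \<forall>z\<in>centre_of S P. lcomp L f (ldelta L P z) = f \<longrightarrow> z = \<one>\<^bsub>S\<^esub>)
      \<and> proj L ` Mor L P Q = F P Q
      \<and> (\<forall>f\<in>Mor L P Q. \<forall>f'\<in>Mor L P Q.
           proj L f = proj L f' \<longleftrightarrow> (\<exists>z\<in>centre_of S P. f' = lcomp L f (ldelta L P z))))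
   \<comment> \<open>(B)\<close>
   \<and> (\<forall>P. F_centric S F P \<longrightarrow> (\<forall>g\<in>P. proj L (ldelta L P g) = restrict (conjm S g) P))
   \<comment> \<open>(C)\<close>
   \<and> (\<forall>P Q f g. F_centric S F P \<and> F_centric S F Q \<and> f \<in> Mor L P Q \<and> g \<in> P \<longrightarrow>
        lcomp L f (ldelta L P g) = lcomp L (ldelta L Q (proj L f g)) f)"

definition finite_p_group :: "nat \<Rightarrow> ('a, 'b) monoid_scheme \<Rightarrow> bool" where
  "finite_p_group p S \<longleftrightarrow> Factorial_Ring.prime p \<and> group S \<and> finite (carrier S) \<and> (\<exists>k. order S = p ^ k)"

definition p_local_finite_group where
  "p_local_finite_group p S F L \<longleftrightarrow>
     finite_p_group p S \<and> saturated p S F \<and> linking_system S F L"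

definition nilpotent_plfg where
  "nilpotent_plfg S F \<longleftrightarrow> (\<forall>P Q. subgroup P S \<and> subgroup Q S \<longrightarrow> F P Q = HomS S P Q)"

definition F_conj_elem where
  "F_conj_elem S F a b \<longleftrightarrow> (\<exists>\<phi>\<in>F (generate S {a}) (carrier S). \<phi> a = b)"

definition S_conj_elem where
  "S_conj_elem S a b \<longleftrightarrow> (\<exists>s\<in>carrier S. conjm S s a = b)"

definition commuting_tuple where
  "commuting_tuple S n as \<longleftrightarrow> length as = n \<and> set as \<subseteq> carrier S \<and>
     (\<forall>i<n. \<forall>j<n. as ! i \<otimes>\<^bsub>S\<^esub> as ! j = as ! j \<otimes>\<^bsub>S\<^esub> as ! i)"

definition F_conj_tuple where
  "F_conj_tuple S F n as bs \<longleftrightarrow>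
     (\<exists>\<phi>\<in>F (generate S (set as)) (carrier S). \<forall>i<n. \<phi> (as ! i) = bs ! i)"

definition S_conj_tuple where
  "S_conj_tuple S n as bs \<longleftrightarrow> (\<exists>s\<in>carrier S. \<forall>i<n. conjm S s (as ! i) = bs ! i)"

end

theory Submission
  imports Defs
begin

text \<open>
  Conditions (1) and (2) are linked by constant tuples. Under (1) an automorphism \<open>\<phi>\<close> in
  \<open>Aut\<^sub>\<F>(P)\<close> moves each \<open>x\<close> to an \<open>S\<close>-conjugate, so it acts trivially on the factors that
  the upper central series of \<open>S\<close> induces on \<open>P\<close>; if \<open>\<phi>\<close> has prime order \<open>q \<noteq> p\<close> it is
  therefore the identity, and Cauchy's theorem gives (3). From (4), nilpotency follows by the
  downward induction of Alperin's fusion theorem: for fully normalized \<open>R\<close> we get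
  \<open>Aut\<^sub>\<F>(R) = Aut\<^sub>S(R)\<close>, either because \<open>R\<close> is centric and \<open>Aut\<^sub>S(R)\<close> is Sylow in a
  \<open>p\<close>-group, or because automorphisms extend to the larger group \<open>R C\<^sub>S(R)\<close>.
\<close>

section \<open>Finite p-groups\<close>

lemma (in group) m_inv_cancel_left:
  assumes "x \<in> carrier G" "y \<in> carrier G"
  shows "inv x \<otimes> (x \<otimes> y) = y" "x \<otimes> (inv x \<otimes> y) = y"
  using assms by (simp_all flip: m_assoc)

lemma (in group_action) orbit_disjoint:
  assumes "A \<in> orbits G E \<phi>" "B \<in> orbits G E \<phi>" "A \<noteq> B"
  shows "A \<inter> B = {}"
  using orbit_partition assms unfolding partition_def by blast

text \<open>Orbit sizes divide a power of \<open>p\<close>, so every orbit that is not a single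
  point has size divisible by \<open>p\<close>. If \<open>x\<close> were the only fixed point, the
  class equation would give \<open>card E\<close> congruent to 1 modulo \<open>p\<close>.\<close>

lemma (in group_action) prime_power_second_fixed_point:
  assumes p: "Factorial_Ring.prime (p::nat)" and ord: "order G = p ^ k"
    and E: "finite E" "p dvd card E"
    and x: "x \<in> E" "\<And>g. g \<in> carrier G \<Longrightarrow> \<phi> g x = x"
  shows "\<exists>y\<in>E. y \<noteq> x \<and> (\<forall>g\<in>carrier G. \<phi> g y = y)"
proof (rule ccontr)
  assume no: "\<not> ?thesis"
  interpret G: group G using group_hom group_hom.axioms(1) by blast
  have sub: "A \<subseteq> E" if "A \<in> orbits G E \<phi>" for A
    using that orbit_partition unfolding partition_def by blast
  have UE: "\<Union>(orbits G E \<phi>) = E"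
    using orbit_partition unfolding partition_def by blast
  have fin: "finite (orbits G E \<phi>)"
    using E(1) sub by (metis Pow_iff finite_Pow_iff finite_subset subsetI)
  have "{x} = orbit G \<phi> x"
    using x(2) G.one_closed by (force simp: orbit_def)
  then have xo: "{x} \<in> orbits G E \<phi>"
    using x(1) by (auto simp: orbits_def)
  have pdvd: "p dvd card A" if A: "A \<in> orbits G E \<phi> - {{x}}" for A
  proof -
    obtain y where y: "y \<in> E" "A = orbit G \<phi> y" using A by (auto simp: orbits_def)
    have "card A dvd p ^ k"
      using orbit_stabilizer_theorem[OF y(1)] ord y(2) by (metis dvd_triv_left)
    then obtain i where i: "card A = p ^ i"
      using p divides_primepow_nat by blast
    show ?thesis
    \<comment> \<open>An orbit of size \<open>p ^ 0\<close> consists of a fixed point, which by the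
      assumption \<open>no\<close> can only be \<open>x\<close>; but the orbit \<open>{x}\<close>
      has been removed.\<close>
    proof (cases "i = 0")
      case True
      then obtain z where z: "A = {z}" using i by (auto simp: card_1_singleton_iff)
      have "z = y" using orbit_refl[OF y(1)] z y(2) by auto
      then have "\<forall>g\<in>carrier G. \<phi> g y = y" using z y(2) by (auto simp: orbit_def)
      then have "y = x" using no y(1) by blast
      with z \<open>z = y\<close> A show ?thesis by auto
    next
      case False
      then show ?thesis using i by (cases i) auto
    qed
  qed
  have "card E = (\<Sum>A\<in>orbits G E \<phi>. card A)"
    using card_Union_disjoint[of "orbits G E \<phi>"] orbit_disjoint finite_subset[OF sub E(1)]
    unfolding UE pairwise_def disjnt_def by blast
  also have "\<dots> = card {x} + (\<Sum>A\<in>orbits G E \<phi> - {{x}}. card A)"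
    by (rule sum.remove[OF fin xo])
  finally have "card E = 1 + (\<Sum>A\<in>orbits G E \<phi> - {{x}}. card A)" by simp
  moreover have "p dvd (\<Sum>A\<in>orbits G E \<phi> - {{x}}. card A)"
    by (rule dvd_sum) (rule pdvd)
  ultimately have "p dvd 1" using E(2) by (metis dvd_add_left_iff)
  then show False using p by (simp add: prime_nat_iff)
qed

text \<open>The group acts on itself by conjugation and fixes \<one>; a second fixed point is a
  nontrivial central element.\<close>

lemma (in group) prime_power_nontrivial_centre:
  assumes p: "Factorial_Ring.prime (p::nat)" and ord: "order G = p ^ k"
    and fin: "finite (carrier G)" and nt: "carrier G \<noteq> {\<one>}"
  shows "\<exists>y\<in>carrier G. y \<noteq> \<one> \<and> (\<forall>g\<in>carrier G. g \<otimes> y = y \<otimes> g)"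
proof -
  interpret act: group_action G "carrier G" "\<lambda>g. \<lambda>h\<in>carrier G. g \<otimes> h \<otimes> inv g"
    by (rule action_by_conjugation)
  have "k \<noteq> 0"
    using ord nt order_one_triv_iff by (metis power_0)
  then have "p dvd card (carrier G)" using ord by (simp add: order_def)
  from act.prime_power_second_fixed_point[OF p ord fin this one_closed]
  obtain y where y: "y \<in> carrier G" "y \<noteq> \<one>" "\<forall>g\<in>carrier G. g \<otimes> y \<otimes> inv g = y" by auto
  have "g \<otimes> y = y \<otimes> g" if "g \<in> carrier G" for g
    using y(1,3) that by (metis inv_solve_right' m_closed)
  then show ?thesis using y by blast
qed

text \<open>The quotient by \<open>M\<close> is a nontrivial p-group, so it has a nontrivial central
  coset, and any representative \<open>y\<close> of it works. This makes the upper central series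
  grow strictly until it reaches the whole group.\<close>

lemma (in group) prime_power_central_mod:
  assumes p: "Factorial_Ring.prime (p::nat)" and ord: "order G = p ^ k"
    and fin: "finite (carrier G)" and M: "M \<lhd> G" "M \<noteq> carrier G"
  shows "\<exists>y\<in>carrier G - M. \<forall>g\<in>carrier G. g \<otimes> y \<otimes> inv g \<otimes> inv y \<in> M"
proof -
  interpret M: normal M G by (rule M(1))
  interpret Q: group "G Mod M" by (rule M.factorgroup_is_group)
  have sM: "subgroup M G" by (rule M.subgroup_axioms)
  have lag: "card (rcosets M) * card M = p ^ k" using lagrange[OF sM] ord by simp
  then have "card (rcosets M) dvd p ^ k" by (metis dvd_triv_left)
  then obtain i where i: "order (G Mod M) = p ^ i"
    using p divides_primepow_nat by (force simp: order_def FactGroup_def)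
  have finQ: "finite (carrier (G Mod M))"
    using fin by (auto simp: FactGroup_def RCOSETS_def)
  have "carrier (G Mod M) \<noteq> {\<one>\<^bsub>G Mod M\<^esub>}"
  proof
    assume "carrier (G Mod M) = {\<one>\<^bsub>G Mod M\<^esub>}"
    then have "card (rcosets M) = 1" by (simp add: FactGroup_def)
    then have "card M = card (carrier G)" using lagrange[OF sM] by (simp add: order_def)
    then show False using M(2) fin M.subset card_subset_eq by blast
  qed
  from Q.prime_power_nontrivial_centre[OF p i finQ this]
  obtain C where C: "C \<in> rcosets M" "C \<noteq> M" "\<forall>D\<in>rcosets M. D <#> C = C <#> D"
    by (auto simp: FactGroup_def)
  obtain y where y: "y \<in> carrier G" "C = M #> y" using C(1) by (auto simp: RCOSETS_def)
  have yM: "y \<notin> M" using C(2) y sM coset_join2 by blast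
  have "g \<otimes> y \<otimes> inv g \<otimes> inv y \<in> M" if g: "g \<in> carrier G" for g
  proof -
    have "M #> g \<in> rcosets M" using g by (auto simp: RCOSETS_def)
    then have "M #> (g \<otimes> y) = M #> (y \<otimes> g)"
      using C(3) y g M.rcos_sum by metis
    \<comment> \<open>The cosets of \<open>g y\<close> and \<open>y g\<close> agree, so the two
      products differ by a left factor \<open>m\<close> in \<open>M\<close>; that factor is the
      commutator.\<close>
    then have "g \<otimes> y \<in> M #> (y \<otimes> g)"
      using rcos_self[OF _ sM] g y by (metis m_closed)
    then obtain m where m: "m \<in> M" "g \<otimes> y = m \<otimes> (y \<otimes> g)" by (auto simp: r_coset_def)
    then have "g \<otimes> y \<otimes> inv (y \<otimes> g) = m"
      using g y M.mem_carrier by (metis inv_solve_right' m_closed)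
    then show ?thesis using m g y by (simp add: inv_mult_group m_assoc)
  qed
  with y yM show ?thesis by blast
qed

text \<open>The preimage of the centre of \<open>G/M\<close>.\<close>

definition comm_into :: "('a, 'b) monoid_scheme \<Rightarrow> 'a set \<Rightarrow> 'a set" where
  "comm_into G M = {y \<in> carrier G. \<forall>g\<in>carrier G. g \<otimes>\<^bsub>G\<^esub> y \<otimes>\<^bsub>G\<^esub> inv\<^bsub>G\<^esub> g \<otimes>\<^bsub>G\<^esub> inv\<^bsub>G\<^esub> y \<in> M}"

lemma (in group) comm_into_normal:
  assumes "M \<lhd> G"
  shows "comm_into G M \<lhd> G" "M \<subseteq> comm_into G M"
proof -
  interpret M: normal M G by (rule assms)
  have Mc: "m \<in> carrier G" if "m \<in> M" for m using that M.mem_carrier by blast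
  show sub: "M \<subseteq> comm_into G M"
    using M.inv_op_closed2 by (auto simp: comm_into_def Mc)
  have conj: "h \<otimes> y \<otimes> inv h \<in> comm_into G M" if y: "y \<in> comm_into G M" and h: "h \<in> carrier G" for y h
  proof -
    have yc: "y \<in> carrier G" using y by (simp add: comm_into_def)
    have "g \<otimes> (h \<otimes> y \<otimes> inv h) \<otimes> inv g \<otimes> inv (h \<otimes> y \<otimes> inv h) \<in> M" if g: "g \<in> carrier G" for g
    proof -
      \<comment> \<open>With \<open>[g,y] = g y g^-1 y^-1\<close>, the identity used is
        \<open>[g, h y h^-1] = [g h, y] [h, y]^-1\<close>.\<close>
      have a: "g \<otimes> h \<otimes> y \<otimes> inv (g \<otimes> h) \<otimes> inv y \<in> M" "h \<otimes> y \<otimes> inv h \<otimes> inv y \<in> M"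
        using y g h by (auto simp: comm_into_def)
      then have "(g \<otimes> h \<otimes> y \<otimes> inv (g \<otimes> h) \<otimes> inv y) \<otimes> inv (h \<otimes> y \<otimes> inv h \<otimes> inv y) \<in> M" by simp
      also have "(g \<otimes> h \<otimes> y \<otimes> inv (g \<otimes> h) \<otimes> inv y) \<otimes> inv (h \<otimes> y \<otimes> inv h \<otimes> inv y)
        = g \<otimes> (h \<otimes> y \<otimes> inv h) \<otimes> inv g \<otimes> inv (h \<otimes> y \<otimes> inv h)"
        using g h yc by (simp add: inv_mult_group m_assoc m_inv_cancel_left)
      finally show ?thesis .
    qed
    then show ?thesis using yc h by (simp add: comm_into_def)
  qed
  have "subgroup (comm_into G M) G"
  proof (rule subgroupI)
    show "comm_into G M \<subseteq> carrier G" by (auto simp: comm_into_def)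
    show "comm_into G M \<noteq> {}" using sub M.one_closed by blast
    show "inv y \<in> comm_into G M" if y: "y \<in> comm_into G M" for y
    proof -
      have yc: "y \<in> carrier G" using y by (simp add: comm_into_def)
      have "g \<otimes> inv y \<otimes> inv g \<otimes> inv (inv y) \<in> M" if g: "g \<in> carrier G" for g
      proof -
        \<comment> \<open>Here \<open>[g, y^-1] = y^-1 [g,y]^-1 y\<close>, a conjugate of an element
          of the normal subgroup \<open>M\<close>.\<close>
        have "g \<otimes> y \<otimes> inv g \<otimes> inv y \<in> M" using y g by (auto simp: comm_into_def)
        then have "inv y \<otimes> inv (g \<otimes> y \<otimes> inv g \<otimes> inv y) \<otimes> y \<in> M"
          using M.inv_op_closed1[OF yc M.m_inv_closed] by blast
        then show ?thesis using g yc by (simp add: inv_mult_group m_assoc m_inv_cancel_left)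
      qed
      then show ?thesis using yc by (simp add: comm_into_def)
    qed
    show "y \<otimes> z \<in> comm_into G M" if y: "y \<in> comm_into G M" and z: "z \<in> comm_into G M" for y z
    proof -
      have c: "y \<in> carrier G" "z \<in> carrier G" using y z by (auto simp: comm_into_def)
      have "g \<otimes> (y \<otimes> z) \<otimes> inv g \<otimes> inv (y \<otimes> z) \<in> M" if g: "g \<in> carrier G" for g
      proof -
        \<comment> \<open>Here \<open>[g, y z] = [g,y] (y [g,z] y^-1)\<close>, and normality of
          \<open>M\<close> absorbs the conjugation by \<open>y\<close>.\<close>
        have a: "g \<otimes> y \<otimes> inv g \<otimes> inv y \<in> M" "g \<otimes> z \<otimes> inv g \<otimes> inv z \<in> M"
          using y z g by (auto simp: comm_into_def)
        then have "(g \<otimes> y \<otimes> inv g \<otimes> inv y) \<otimes> (y \<otimes> (g \<otimes> z \<otimes> inv g \<otimes> inv z) \<otimes> inv y) \<in> M"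
          using M.inv_op_closed2[OF c(1)] by blast
        also have "(g \<otimes> y \<otimes> inv g \<otimes> inv y) \<otimes> (y \<otimes> (g \<otimes> z \<otimes> inv g \<otimes> inv z) \<otimes> inv y)
          = g \<otimes> (y \<otimes> z) \<otimes> inv g \<otimes> inv (y \<otimes> z)"
          using g c by (simp add: inv_mult_group m_assoc m_inv_cancel_left)
        finally show ?thesis .
      qed
      then show ?thesis using c by (simp add: comm_into_def)
    qed
  qed
  then show "comm_into G M \<lhd> G" using conj by (simp add: normal_inv_iff)
qed

text \<open>Induction along the upper central series without indexing its terms: as long as
  \<open>M\<close> is proper, \<open>comm_into G M\<close> is strictly larger, so in a finite group
  the process ends at \<open>carrier G\<close>.\<close>

lemma (in group) central_series_induct:
  assumes p: "Factorial_Ring.prime (p::nat)" "order G = p ^ k" "finite (carrier G)"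
    and one: "P {\<one>}"
    and step: "\<And>M. M \<lhd> G \<Longrightarrow> P M \<Longrightarrow> M \<noteq> carrier G \<Longrightarrow> P (comm_into G M)"
  shows "P (carrier G)"
proof -
  have "P (carrier G)" if "M \<lhd> G" "P M" for M
    using that
  proof (induction "card (carrier G) - card M" arbitrary: M rule: less_induct)
    case less
    show ?case
    proof (cases "M = carrier G")
      case False
      have N: "comm_into G M \<lhd> G" "M \<subseteq> comm_into G M" using comm_into_normal less.prems by auto
      have "M \<noteq> comm_into G M"
        using prime_power_central_mod[OF p less.prems(1) False] by (auto simp: comm_into_def)
      moreover have "comm_into G M \<subseteq> carrier G" by (auto simp: comm_into_def)
      ultimately have "card M < card (comm_into G M)" "card (comm_into G M) \<le> card (carrier G)"
        using N(2) p(3) psubset_card_mono[of "comm_into G M" M] card_mono[of "carrier G" "comm_into G M"]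
        by (simp_all add: finite_subset psubset_eq)
      then show ?thesis
        using less.hyps[OF _ N(1) step[OF less.prems False]] by linarith
    qed (use less.prems in auto)
  qed
  then show ?thesis using one one_is_normal by blast
qed

section \<open>Conjugation and normalizers\<close>

lemma (in group) normS_subgroup:
  assumes "P \<subseteq> carrier G"
  shows "subgroup (normS G P) G"
proof (rule subgroupI)
  have c: "conjm G (g \<otimes> h) ` P = conjm G g ` conjm G h ` P" if "g \<in> carrier G" "h \<in> carrier G" for g h
    unfolding image_image using that assms
    by (intro image_cong) (auto simp: conjm_def inv_mult_group m_assoc subset_iff)
  have "conjm G \<one> ` P = id ` P"
    by (rule image_cong) (use assms in \<open>auto simp: conjm_def\<close>)
  then have one: "conjm G \<one> ` P = P" by simp
  show "normS G P \<subseteq> carrier G" by (auto simp: normS_def)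
  show "normS G P \<noteq> {}" using one by (auto simp: normS_def)
  show "inv g \<in> normS G P" if "g \<in> normS G P" for g
  proof -
    have g: "g \<in> carrier G" "conjm G g ` P = P" using that by (auto simp: normS_def)
    then have "conjm G (inv g) ` P = P" using c[of "inv g" g] one by simp
    then show ?thesis using g(1) by (simp add: normS_def)
  qed
  show "g \<otimes> h \<in> normS G P" if "g \<in> normS G P" "h \<in> normS G P" for g h
    using that c[of g h] by (simp add: normS_def)
qed

lemma (in group) conjm_closed [simp]:
  "g \<in> carrier G \<Longrightarrow> x \<in> carrier G \<Longrightarrow> conjm G g x \<in> carrier G"
  by (simp add: conjm_def)

lemma (in group) conjm_comp:
  "g \<in> carrier G \<Longrightarrow> h \<in> carrier G \<Longrightarrow> x \<in> carrier G \<Longrightarrow> conjm G g (conjm G h x) = conjm G (g \<otimes> h) x"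
  by (simp add: conjm_def inv_mult_group m_assoc)

lemma (in group) conjm_one [simp]: "x \<in> carrier G \<Longrightarrow> conjm G \<one> x = x"
  by (simp add: conjm_def)

lemma (in group) conjm_inv_cancel [simp]:
  "g \<in> carrier G \<Longrightarrow> x \<in> carrier G \<Longrightarrow> conjm G (inv g) (conjm G g x) = x"
  "g \<in> carrier G \<Longrightarrow> x \<in> carrier G \<Longrightarrow> conjm G g (conjm G (inv g) x) = x"
  by (simp_all add: conjm_comp)

lemma (in group) inj_on_conjm: "g \<in> carrier G \<Longrightarrow> P \<subseteq> carrier G \<Longrightarrow> inj_on (conjm G g) P"
  by (rule inj_on_inverseI[where g = "conjm G (inv g)"]) (auto simp: subset_iff)

text \<open>Conjugation is injective, and an injective map of a finite set into itself is onto;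
  hence the inclusion of the image in \<open>P\<close> already gives equality.\<close>

lemma (in group) normSI:
  assumes "g \<in> carrier G" "finite P" "P \<subseteq> carrier G" "\<And>x. x \<in> P \<Longrightarrow> conjm G g x \<in> P"
  shows "g \<in> normS G P"
proof -
  have "conjm G g ` P = P"
    by (rule endo_inj_surj[OF assms(2) _ inj_on_conjm[OF assms(1,3)]]) (use assms(4) in blast)
  then show ?thesis using assms(1) by (simp add: normS_def)
qed

lemma (in group) subgroup_conjm:
  assumes "subgroup P G" "g \<in> P" "x \<in> P" shows "conjm G g x \<in> P"
  using assms by (simp add: conjm_def subgroup.m_closed subgroup.m_inv_closed)

text \<open>A term of the upper central series normalizes \<open>P\<close> as soon as the preceding term lies
  in \<open>P\<close>, so \<open>N(P) = P\<close> would force the whole series into \<open>P\<close>.\<close>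

lemma (in group) prime_power_normalizer_grows:
  assumes p: "Factorial_Ring.prime (p::nat)" "order G = p ^ k" "finite (carrier G)"
    and P: "subgroup P G" "P \<noteq> carrier G"
  shows "P \<subset> normS G P"
proof -
  have Pc: "P \<subseteq> carrier G" using P(1) subgroup.subset by blast
  have fP: "finite P" using p(3) Pc finite_subset by blast
  have PN: "P \<subseteq> normS G P"
    using Pc fP subgroup_conjm[OF P(1)] by (auto intro!: normSI)
  have "normS G P \<noteq> P"
  proof
    assume eq: "normS G P = P"
    have "carrier G \<subseteq> P"
    proof (rule central_series_induct[OF p])
      show "{\<one>} \<subseteq> P" using P(1) subgroup.one_closed by blast
      fix M assume M: "M \<lhd> G" "M \<subseteq> P"
      show "comm_into G M \<subseteq> P"
      proof
        fix y assume y: "y \<in> comm_into G M"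
        then have yc: "y \<in> carrier G" by (simp add: comm_into_def)
        have "conjm G y x \<in> P" if x: "x \<in> P" for x
        proof -
          have xc: "x \<in> carrier G" using x Pc by blast
          \<comment> \<open>The conjugate is recovered from \<open>y x y^-1 = [x,y]^-1 x\<close>,
            where \<open>[x,y]\<close> lies in \<open>M\<close> and hence in
            \<open>P\<close>.\<close>
          have "x \<otimes> y \<otimes> inv x \<otimes> inv y \<in> P" using y xc M(2) by (auto simp: comm_into_def)
          then have "inv (x \<otimes> y \<otimes> inv x \<otimes> inv y) \<otimes> x \<in> P"
            using P(1) x by (simp add: subgroup.m_closed subgroup.m_inv_closed)
          also have "inv (x \<otimes> y \<otimes> inv x \<otimes> inv y) \<otimes> x = conjm G y x"
            using xc yc by (simp add: conjm_def inv_mult_group m_assoc)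
          finally show ?thesis .
        qed
        then have "y \<in> normS G P" using yc fP Pc by (intro normSI) auto
        then show "y \<in> P" using eq by simp
      qed
    qed
    then show False using P(2) Pc by blast
  qed
  then show ?thesis using PN by blast
qed

section \<open>Recognizing p-groups by their elements of prime order\<close>

lemma prime_powerI:
  fixes n p :: nat
  assumes "n > 0" "\<And>q. Factorial_Ring.prime q \<Longrightarrow> q dvd n \<Longrightarrow> q = p"
  shows "\<exists>k. n = p ^ k"
  using assms
proof (induction n rule: less_induct)
  case (less n)
  show ?case
  proof (cases "n = 1")
    case True then show ?thesis by (auto intro: exI[of _ 0])
  next
    case False
    then obtain q where q: "Factorial_Ring.prime q" "q dvd n" using prime_factor_nat by blast
    then have qp: "q = p" using less.prems by blast
    obtain m where m: "n = p * m" using q qp by blast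
    have "p > 1" using q(1) qp prime_gt_1_nat by blast
    then have "m < n" "m > 0" using m less.prems(1) by simp_all
    moreover have "r = p" if "Factorial_Ring.prime r" "r dvd m" for r
      using less.prems(2)[OF that(1)] that(2) m by simp
    ultimately obtain k where "m = p ^ k" using less.IH by blast
    then show ?thesis using m by (metis power_Suc)
  qed
qed

text \<open>This is Cauchy's theorem in contrapositive form. For a prime \<open>q\<close> dividing
  the order, Sylow's theorem at exponent 1 gives a subgroup of order \<open>q\<close>, all of whose
  elements satisfy \<open>x^q = 1\<close>; for \<open>q \<noteq> p\<close> the hypothesis would make
  it trivial.\<close>

lemma (in group) prime_power_orderI:
  assumes fin: "finite (carrier G)"
    and el: "\<And>q x. Factorial_Ring.prime (q::nat) \<Longrightarrow> q \<noteq> p \<Longrightarrow> x \<in> carrier G \<Longrightarrow> x [^] q = \<one> \<Longrightarrow> x = \<one>"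
  shows "\<exists>k. card (carrier G) = p ^ k"
proof (rule prime_powerI)
  show "card (carrier G) > 0" using fin one_closed card_gt_0_iff by blast
  fix q assume q: "Factorial_Ring.prime q" "q dvd card (carrier G)"
  show "q = p"
  proof (rule ccontr)
    assume ne: "q \<noteq> p"
    obtain m where m: "order G = q ^ 1 * m" using q(2) by (auto simp: order_def)
    from sylow_thm[OF q(1) is_group m fin]
    obtain H where H: "subgroup H G" "card H = q" by auto
    interpret H: group "G\<lparr>carrier := H\<rparr>" using H(1) by (rule subgroup_imp_group)
    have "x = \<one>" if x: "x \<in> H" for x
    proof -
      have "x [^] q = \<one>"
        using H.pow_order_eq_1[of x] x H(2) by (simp add: order_def nat_pow_consistent[of x q H])
      then show ?thesis using el[OF q(1) ne subgroup.mem_carrier[OF H(1) x]] by blast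
    qed
    then have "H \<subseteq> {\<one>}" by blast
    then have "card H \<le> card {\<one>}" by (intro card_mono) simp_all
    then show False using H(2) q(1) prime_gt_1_nat[of q] by simp
  qed
qed

section \<open>Fusion systems\<close>

locale finite_fusion_system = group S for S (structure) +
  fixes F :: "'a set \<Rightarrow> 'a set \<Rightarrow> ('a \<Rightarrow> 'a) set"
  assumes fin: "finite (carrier S)" and fusion: "fusion_system S F"
begin

abbreviation carr :: "'a set" where "carr \<equiv> carrier S"

lemma subgroup_finite: "subgroup P S \<Longrightarrow> finite P"
  using fin subgroup.subset finite_subset by metis

lemma subgroup_self [simp]: "subgroup carr S"
  by (rule subgroup_self)

lemma F_InjS:
  assumes "subgroup P S" "subgroup Q S" "\<phi> \<in> F P Q"
  shows "\<phi> \<in> InjS S P Q"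
  using fusion assms unfolding fusion_system_def by blast

lemma HomS_F:
  assumes "subgroup P S" "subgroup Q S" "\<phi> \<in> HomS S P Q"
  shows "\<phi> \<in> F P Q"
  using fusion assms unfolding fusion_system_def by blast

lemma F_compose:
  assumes "subgroup P S" "subgroup Q S" "subgroup R S" "\<phi> \<in> F P Q" "\<psi> \<in> F Q R"
  shows "compose P \<psi> \<phi> \<in> F P R"
  using fusion assms unfolding fusion_system_def by blast

lemma F_iso_image:
  assumes "subgroup P S" "subgroup Q S" "\<phi> \<in> F P Q"
  shows "F_iso S F P (\<phi> ` P) \<phi>"
  using fusion assms unfolding fusion_system_def by blast

lemma F_map:
  assumes "subgroup P S" "subgroup Q S" "\<phi> \<in> F P Q"
  shows "\<phi> \<in> extensional P" "\<And>x. x \<in> P \<Longrightarrow> \<phi> x \<in> Q" "inj_on \<phi> P"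
    "\<And>x y. x \<in> P \<Longrightarrow> y \<in> P \<Longrightarrow> \<phi> (x \<otimes> y) = \<phi> x \<otimes> \<phi> y"
  using F_InjS[OF assms] by (auto simp: InjS_def)

lemma F_group_hom:
  assumes "subgroup P S" "subgroup Q S" "\<phi> \<in> F P Q"
  shows "group_hom (S\<lparr>carrier := P\<rparr>) S \<phi>"
proof -
  interpret P: group "S\<lparr>carrier := P\<rparr>" using assms(1) by (rule subgroup_imp_group)
  show ?thesis
    using F_map[OF assms] subgroup.subset[OF assms(2)]
    by unfold_locales (auto simp: hom_def)
qed

lemma F_inv:
  assumes "subgroup P S" "subgroup Q S" "\<phi> \<in> F P Q" "x \<in> P"
  shows "\<phi> (inv x) = inv (\<phi> x)"
  using group_hom.hom_inv[OF F_group_hom[OF assms(1-3)], of x] assms(1,4)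
  by (simp add: m_inv_consistent)

lemma F_one:
  assumes "subgroup P S" "subgroup Q S" "\<phi> \<in> F P Q"
  shows "\<phi> \<one> = \<one>"
  using group_hom.hom_one[OF F_group_hom[OF assms]] by simp

lemma F_image_subgroup:
  assumes "subgroup P S" "subgroup Q S" "\<phi> \<in> F P Q"
  shows "subgroup (\<phi> ` P) S"
  using group_hom.img_is_subgroup[OF F_group_hom[OF assms]] by simp

text \<open>The inclusion is conjugation by \<one>, hence one of the maps in \<open>HomS\<close>
  that every fusion system contains.\<close>

lemma F_incl:
  assumes "subgroup P S" "subgroup Q S" "P \<subseteq> Q"
  shows "restrict id P \<in> F P Q"
proof (rule HomS_F[OF assms(1,2)])
  have "x \<in> P \<Longrightarrow> x \<in> carr" for x using assms(1) subgroup.mem_carrier by metis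
  then have eq: "x \<in> P \<Longrightarrow> conjm S \<one> x = x" for x by simp
  then have "restrict id P = restrict (conjm S \<one>) P" by (auto simp: restrict_def fun_eq_iff)
  moreover have "conjm S \<one> ` P \<subseteq> Q" using eq assms(3) by auto
  ultimately show "restrict id P \<in> HomS S P Q" unfolding HomS_def by blast
qed

lemma F_restrict:
  assumes "subgroup P S" "subgroup Q S" "\<phi> \<in> F P Q" "subgroup R S" "R \<subseteq> P"
  shows "restrict \<phi> R \<in> F R Q"
proof -
  have "compose R \<phi> (restrict id R) = restrict \<phi> R" by (auto simp: compose_def fun_eq_iff)
  then show ?thesis using F_compose[OF assms(4,1,2) F_incl[OF assms(4,1,5)] assms(3)] by simp
qed

text \<open>A morphism is an isomorphism onto its image followed by an inclusion, so another
  inclusion can be composed instead. The target may thus be shrunk as well as enlarged.\<close>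

lemma F_codomain:
  assumes "subgroup P S" "subgroup Q S" "\<phi> \<in> F P Q" "subgroup R S" "\<phi> ` P \<subseteq> R"
  shows "\<phi> \<in> F P R"
proof -
  have i: "\<phi> \<in> F P (\<phi> ` P)" using F_iso_image[OF assms(1-3)] by (simp add: F_iso_def)
  have s: "subgroup (\<phi> ` P) S" by (rule F_image_subgroup[OF assms(1-3)])
  have "compose P (restrict id (\<phi> ` P)) \<phi> = \<phi>"
    using F_map(1)[OF assms(1-3)] by (auto simp: compose_def extensional_def fun_eq_iff)
  then show ?thesis using F_compose[OF assms(1) s assms(4) i F_incl[OF s assms(4,5)]] by simp
qed

lemma F_carr:
  assumes "subgroup P S" "subgroup Q S" "\<phi> \<in> F P Q"
  shows "\<phi> \<in> F P carr"
  using F_codomain[OF assms] F_image_subgroup[OF assms, THEN subgroup.subset] by simp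

lemma F_inverse:
  assumes "subgroup P S" "subgroup Q S" "\<phi> \<in> F P Q" "\<phi> ` P = Q"
  obtains \<psi> where "\<psi> \<in> F Q P" "\<And>x. x \<in> P \<Longrightarrow> \<psi> (\<phi> x) = x" "\<And>y. y \<in> Q \<Longrightarrow> \<phi> (\<psi> y) = y" "\<psi> ` Q = P"
proof -
  obtain \<psi> where \<psi>: "\<psi> \<in> F Q P" "compose P \<psi> \<phi> = restrict id P" "compose Q \<phi> \<psi> = restrict id Q"
    using F_iso_image[OF assms(1-3)] assms(4) by (auto simp: F_iso_def)
  have 1: "\<psi> (\<phi> x) = x" if "x \<in> P" for x
    using fun_cong[OF \<psi>(2), of x] that by (simp add: compose_def)
  have 2: "\<phi> (\<psi> x) = x" if "x \<in> Q" for x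
    using fun_cong[OF \<psi>(3), of x] that by (simp add: compose_def)
  have "\<psi> ` Q = P"
    using assms(4) 1 F_map(2)[OF assms(2,1) \<psi>(1)] by (force simp: image_iff)
  then show ?thesis using that \<psi>(1) 1 2 by blast
qed

text \<open>The factorization axiom supplies an inverse morphism on the image, so a surjective
  morphism is automatically an isomorphism of the fusion system.\<close>

lemma F_conj_sub_iff:
  "F_conj_sub S F P Q \<longleftrightarrow> subgroup P S \<and> subgroup Q S \<and> (\<exists>\<phi>\<in>F P Q. \<phi> ` P = Q)"
proof
  assume L: "F_conj_sub S F P Q"
  then obtain \<phi> \<psi> where PQ: "subgroup P S" "subgroup Q S" "\<phi> \<in> F P Q" "\<psi> \<in> F Q P"
    and c: "compose Q \<phi> \<psi> = restrict id Q"
    by (auto simp: F_conj_sub_def F_iso_def)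
  have "\<phi> (\<psi> y) = y" if "y \<in> Q" for y
    using fun_cong[OF c, of y] that by (simp add: compose_def)
  then have "Q \<subseteq> \<phi> ` P" using F_map(2)[OF PQ(2,1,4)] by (metis image_eqI subsetI)
  moreover have "\<phi> ` P \<subseteq> Q" using F_map(2)[OF PQ(1-3)] by blast
  ultimately show "subgroup P S \<and> subgroup Q S \<and> (\<exists>\<phi>\<in>F P Q. \<phi> ` P = Q)" using PQ by blast
next
  assume "subgroup P S \<and> subgroup Q S \<and> (\<exists>\<phi>\<in>F P Q. \<phi> ` P = Q)"
  then show "F_conj_sub S F P Q" using F_iso_image by (auto simp: F_conj_sub_def)
qed

lemma F_conj_sub_refl: "subgroup P S \<Longrightarrow> F_conj_sub S F P P"
  unfolding F_conj_sub_iff by (intro conjI bexI[OF _ F_incl]) auto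

lemma F_conj_sub_sym: "F_conj_sub S F P Q \<Longrightarrow> F_conj_sub S F Q P"
  unfolding F_conj_sub_iff by (metis F_inverse)

lemma F_conj_sub_trans:
  assumes "F_conj_sub S F P Q" "F_conj_sub S F Q R"
  shows "F_conj_sub S F P R"
proof -
  obtain \<phi> \<psi> where h: "subgroup P S" "subgroup Q S" "subgroup R S" "\<phi> \<in> F P Q" "\<psi> \<in> F Q R"
    "\<phi> ` P = Q" "\<psi> ` Q = R"
    using assms by (auto simp: F_conj_sub_iff)
  have "compose P \<psi> \<phi> ` P = R" using h(6,7) by (auto simp: compose_def)
  then show ?thesis using F_compose[OF h(1-5)] h(1,3) by (auto simp: F_conj_sub_iff)
qed

lemma F_conj_sub_card:
  assumes "F_conj_sub S F P Q"
  shows "card P = card Q"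
proof -
  obtain \<phi> where h: "subgroup P S" "subgroup Q S" "\<phi> \<in> F P Q" "\<phi> ` P = Q"
    using assms by (auto simp: F_conj_sub_iff)
  show ?thesis using card_image[OF F_map(3)[OF h(1-3)]] h(4) by simp
qed

text \<open>Orders of normalizers are bounded by that of \<open>S\<close>, so some conjugate
  \<open>R\<close> of \<open>P\<close> attains the maximum. Transitivity makes it maximal among the
  conjugates of \<open>R\<close> too, which is what the definition asks.\<close>

lemma fully_normalized_exists:
  assumes "subgroup P S"
  obtains R where "F_conj_sub S F P R" "fully_normalized S F R"
proof -
  have "card (normS S R) \<le> card carr" for R
    by (rule card_mono[OF fin]) (auto simp: normS_def)
  then have "\<exists>R. F_conj_sub S F P R \<and>
      (\<forall>R'. F_conj_sub S F P R' \<longrightarrow> card (normS S R') \<le> card (normS S R))"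
    using ex_has_greatest_nat[of "F_conj_sub S F P" P "\<lambda>R. card (normS S R)" "Suc (card carr)"]
      F_conj_sub_refl[OF assms] by (simp add: le_imp_less_Suc)
  then obtain R where R: "F_conj_sub S F P R"
    and max: "\<And>R'. F_conj_sub S F P R' \<Longrightarrow> card (normS S R') \<le> card (normS S R)"
    by blast
  have "fully_normalized S F R"
    unfolding fully_normalized_def
    using R max F_conj_sub_trans[OF R] by (simp add: F_conj_sub_def)
  then show ?thesis using that R by blast
qed

section \<open>Automorphism groups in a fusion system\<close>

lemma autF_image:
  assumes "subgroup P S" "\<phi> \<in> F P P"
  shows "\<phi> ` P = P"
  using F_map(2,3)[OF assms(1,1,2)] by (intro endo_inj_surj subgroup_finite[OF assms(1)]) auto

lemma autF_group:
  assumes P: "subgroup P S"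
  shows "group (autF S F P)"
proof (rule groupI)
  note ext = F_map(1)[OF P P] and mem = F_map(2)[OF P P]
  show "\<phi> \<otimes>\<^bsub>autF S F P\<^esub> \<psi> \<in> carrier (autF S F P)"
    if "\<phi> \<in> carrier (autF S F P)" "\<psi> \<in> carrier (autF S F P)" for \<phi> \<psi>
    using that F_compose[OF P P P] by (simp add: autF_def)
  show "\<one>\<^bsub>autF S F P\<^esub> \<in> carrier (autF S F P)"
    using F_incl[OF P P] by (simp add: autF_def)
  show "\<phi> \<otimes>\<^bsub>autF S F P\<^esub> \<psi> \<otimes>\<^bsub>autF S F P\<^esub> \<chi> = \<phi> \<otimes>\<^bsub>autF S F P\<^esub> (\<psi> \<otimes>\<^bsub>autF S F P\<^esub> \<chi>)"
    if "\<phi> \<in> carrier (autF S F P)" "\<psi> \<in> carrier (autF S F P)" "\<chi> \<in> carrier (autF S F P)" for \<phi> \<psi> \<chi>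
    using that mem by (auto simp: autF_def compose_def fun_eq_iff)
  show "\<one>\<^bsub>autF S F P\<^esub> \<otimes>\<^bsub>autF S F P\<^esub> \<phi> = \<phi>" if "\<phi> \<in> carrier (autF S F P)" for \<phi>
    using that mem ext by (fastforce simp: autF_def compose_def fun_eq_iff extensional_def)
  show "\<exists>\<psi>\<in>carrier (autF S F P). \<psi> \<otimes>\<^bsub>autF S F P\<^esub> \<phi> = \<one>\<^bsub>autF S F P\<^esub>"
    if a: "\<phi> \<in> carrier (autF S F P)" for \<phi>
  proof -
    have \<phi>: "\<phi> \<in> F P P" using a by (simp add: autF_def)
    obtain \<psi> where "\<psi> \<in> F P P" "\<And>x. x \<in> P \<Longrightarrow> \<psi> (\<phi> x) = x"
      using F_inverse[OF P P \<phi> autF_image[OF P \<phi>]] by metis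
    then show ?thesis by (auto simp: autF_def compose_def fun_eq_iff intro!: bexI[of _ \<psi>])
  qed
qed

lemma autF_finite:
  assumes P: "subgroup P S"
  shows "finite (carrier (autF S F P))"
proof (rule finite_subset)
  show "carrier (autF S F P) \<subseteq> P \<rightarrow>\<^sub>E P"
    using F_map(1,2)[OF P P] by (auto simp: autF_def PiE_def)
  show "finite (P \<rightarrow>\<^sub>E P)" using subgroup_finite[OF P] by (simp add: finite_PiE)
qed

text \<open>Since \<phi> fixes \<open>m\<close>, each further application only multiplies by one
  more \<open>m\<close>. If \<phi> has finite order, the power of \<open>m\<close> with that
  exponent is therefore trivial.\<close>

lemma autF_pow_fixed_defect:
  assumes P: "subgroup P S" and \<phi>: "\<phi> \<in> F P P" and x: "x \<in> P" and m: "m \<in> P" "\<phi> m = m"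
    and \<phi>x: "\<phi> x = m \<otimes> x"
  shows "(\<phi> [^]\<^bsub>autF S F P\<^esub> (n::nat)) x = m [^] n \<otimes> x"
proof (induction n)
  case 0
  then show ?case using x P subgroup.mem_carrier by (fastforce simp: autF_def)
next
  case (Suc n)
  interpret A: group "autF S F P" by (rule autF_group[OF P])
  have \<phi>A: "\<phi> \<in> carrier (autF S F P)" using \<phi> by (simp add: autF_def)
  have c: "m \<in> carr" "x \<in> carr" using P x m(1) subgroup.mem_carrier by metis+
  have pow: "m [^] k \<in> P \<and> \<phi> (m [^] k) = m [^] k" for k :: nat
  proof (induction k)
    case 0
    then show ?case using F_one[OF P P \<phi>] P by (simp add: subgroup.one_closed)
  next
    case (Suc k)
    then show ?case using F_map(4)[OF P P \<phi>, of "m [^] k" m] m P by (simp add: subgroup.m_closed)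
  qed
  have "\<phi> [^]\<^bsub>autF S F P\<^esub> Suc n = \<phi> \<otimes>\<^bsub>autF S F P\<^esub> \<phi> [^]\<^bsub>autF S F P\<^esub> n"
    by (rule A.nat_pow_Suc2[OF \<phi>A])
  then have "(\<phi> [^]\<^bsub>autF S F P\<^esub> Suc n) x = \<phi> ((\<phi> [^]\<^bsub>autF S F P\<^esub> n) x)"
    using x by (simp add: autF_def compose_def)
  also have "\<dots> = m [^] n \<otimes> (m \<otimes> x)"
    using Suc pow[of n] F_map(4)[OF P P \<phi>, of "m [^] n" x] x \<phi>x by simp
  finally show ?case using c by (simp add: m_assoc)
qed

section \<open>Conjugation maps and the extension domain \<open>N_phi\<close>\<close>

lemma HomS_carr_iff:
  assumes "subgroup P S"
  shows "\<phi> \<in> HomS S P carr \<longleftrightarrow>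
    \<phi> \<in> extensional P \<and> (\<exists>s\<in>carr. \<forall>x\<in>P. \<phi> x = conjm S s x)"
proof
  assume "\<phi> \<in> HomS S P carr"
  then show "\<phi> \<in> extensional P \<and> (\<exists>s\<in>carr. \<forall>x\<in>P. \<phi> x = conjm S s x)"
    by (auto simp: HomS_def)
next
  assume "\<phi> \<in> extensional P \<and> (\<exists>s\<in>carr. \<forall>x\<in>P. \<phi> x = conjm S s x)"
  then obtain s where s: "s \<in> carr" "\<phi> \<in> extensional P" "\<forall>x\<in>P. \<phi> x = conjm S s x" by blast
  then have "\<phi> = restrict (conjm S s) P" by (auto simp: fun_eq_iff extensional_def)
  moreover have "conjm S s ` P \<subseteq> carr" using s(1) subgroup.mem_carrier[OF assms] by auto
  ultimately show "\<phi> \<in> HomS S P carr" using s(1) unfolding HomS_def by blast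
qed

lemma HomS_iff:
  assumes "subgroup P S" "subgroup Q S"
  shows "\<phi> \<in> HomS S P Q \<longleftrightarrow> \<phi> \<in> HomS S P carr \<and> \<phi> ` P \<subseteq> Q"
  using subgroup.subset[OF assms(2)] by (fastforce simp: HomS_def)

text \<open>Putting \<open>y = \<phi> x\<close> removes \<open>inv_into\<close> from the definition:
  \<open>g\<close> belongs to the domain when \<phi> turns conjugation by \<open>g\<close> into
  conjugation by some partner \<open>t\<close> in \<open>S\<close>.\<close>

lemma N_phi_iff:
  assumes P: "subgroup P S" and \<phi>: "\<phi> \<in> F P carr"
  shows "g \<in> N_phi S P \<phi> \<longleftrightarrow>
    g \<in> normS S P \<and> (\<exists>t\<in>carr. \<forall>x\<in>P. \<phi> (conjm S g x) = conjm S t (\<phi> x))"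
proof -
  let ?h = "restrict (\<lambda>y. \<phi> (conjm S g (inv_into P \<phi> y))) (\<phi> ` P)"
  have sub: "subgroup (\<phi> ` P) S" by (rule F_image_subgroup[OF P subgroup_self \<phi>])
  have inv: "inv_into P \<phi> (\<phi> x) = x" if "x \<in> P" for x
    using F_map(3)[OF P subgroup_self \<phi>] that by (rule inv_into_f_f)
  have "?h \<in> HomS S (\<phi> ` P) (\<phi> ` P) \<longleftrightarrow> (\<exists>t\<in>carr. \<forall>x\<in>P. \<phi> (conjm S g x) = conjm S t (\<phi> x))"
    if g: "g \<in> normS S P"
  proof -
    have "conjm S g x \<in> P" if "x \<in> P" for x using g that by (auto simp: normS_def)
    then have "?h ` \<phi> ` P \<subseteq> \<phi> ` P" using inv by auto
    then show ?thesis
      unfolding HomS_iff[OF sub sub] HomS_carr_iff[OF sub] using inv by simp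
  qed
  then show ?thesis by (auto simp: N_phi_def)
qed

text \<open>Inverses and products of partners are partners of the corresponding inverses and
  products.\<close>

lemma N_phi_subgroup:
  assumes P: "subgroup P S" and \<phi>: "\<phi> \<in> F P carr"
  shows "subgroup (N_phi S P \<phi>) S"
proof (rule subgroupI)
  note iff = N_phi_iff[OF P \<phi>]
  have N: "subgroup (normS S P) S" by (rule normS_subgroup[OF subgroup.subset[OF P]])
  have Nc: "g \<in> carr" if "g \<in> normS S P" for g using that by (simp add: normS_def)
  have Nm: "conjm S g x \<in> P" if "g \<in> normS S P" "x \<in> P" for g x using that by (auto simp: normS_def)
  have Pc: "x \<in> carr" "\<phi> x \<in> carr" if "x \<in> P" for x
    using that subgroup.mem_carrier[OF P] F_map(2)[OF P subgroup_self \<phi>] by auto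
  show "N_phi S P \<phi> \<subseteq> carr" using iff Nc by blast
  have "\<one> \<in> N_phi S P \<phi>"
    unfolding iff using subgroup.one_closed[OF N] Pc by (intro conjI bexI[of _ \<one>]) auto
  then show "N_phi S P \<phi> \<noteq> {}" by blast
  show "inv g \<in> N_phi S P \<phi>" if "g \<in> N_phi S P \<phi>" for g
  proof -
    obtain t where g: "g \<in> normS S P" "t \<in> carr" "\<And>x. x \<in> P \<Longrightarrow> \<phi> (conjm S g x) = conjm S t (\<phi> x)"
      using \<open>g \<in> N_phi S P \<phi>\<close> iff by blast
    have g': "inv g \<in> normS S P" using subgroup.m_inv_closed[OF N g(1)] .
    have "\<phi> (conjm S (inv g) x) = conjm S (inv t) (\<phi> x)" if x: "x \<in> P" for x
    proof -
      have "\<phi> x = conjm S t (\<phi> (conjm S (inv g) x))"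
        using g(3)[OF Nm[OF g' x]] Nc[OF g(1)] Pc(1)[OF x] by simp
      then show ?thesis using g(2) Pc(2)[OF Nm[OF g' x]] by simp
    qed
    then show ?thesis unfolding iff using g' g(2) by blast
  qed
  show "g \<otimes> h \<in> N_phi S P \<phi>" if "g \<in> N_phi S P \<phi>" "h \<in> N_phi S P \<phi>" for g h
  proof -
    obtain t where g: "g \<in> normS S P" "t \<in> carr" "\<And>x. x \<in> P \<Longrightarrow> \<phi> (conjm S g x) = conjm S t (\<phi> x)"
      using \<open>g \<in> N_phi S P \<phi>\<close> iff by blast
    obtain u where h: "h \<in> normS S P" "u \<in> carr" "\<And>x. x \<in> P \<Longrightarrow> \<phi> (conjm S h x) = conjm S u (\<phi> x)"
      using \<open>h \<in> N_phi S P \<phi>\<close> iff by blast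
    have "\<phi> (conjm S (g \<otimes> h) x) = conjm S (t \<otimes> u) (\<phi> x)" if x: "x \<in> P" for x
    proof -
      have "\<phi> (conjm S (g \<otimes> h) x) = \<phi> (conjm S g (conjm S h x))"
        using Nc[OF g(1)] Nc[OF h(1)] Pc(1)[OF x] by (simp add: conjm_comp)
      also have "\<dots> = conjm S t (conjm S u (\<phi> x))"
        using g(3)[OF Nm[OF h(1) x]] h(3)[OF x] by simp
      also have "\<dots> = conjm S (t \<otimes> u) (\<phi> x)"
        using g(2) h(2) Pc(2)[OF x] by (simp add: conjm_comp)
      finally show ?thesis .
    qed
    then show ?thesis
      unfolding iff using subgroup.m_closed[OF N g(1) h(1)] g(2) h(2) by blast
  qed
qed

text \<open>The partner of \<open>g\<close> in \<open>P\<close> is \<open>\<phi> g\<close>, and the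
  partner of an element centralizing \<open>P\<close> is \<one>. Thus \<phi> has room to extend
  whenever \<open>C\<^sub>S(P)\<close> is not contained in \<open>P\<close>.\<close>

lemma N_phi_contains:
  assumes P: "subgroup P S" and \<phi>: "\<phi> \<in> F P carr"
  shows "P \<subseteq> N_phi S P \<phi>" "centS S P \<subseteq> N_phi S P \<phi>"
proof -
  note iff = N_phi_iff[OF P \<phi>]
  have Pc: "x \<in> carr" "\<phi> x \<in> carr" if "x \<in> P" for x
    using that subgroup.mem_carrier[OF P] F_map(2)[OF P subgroup_self \<phi>] by auto
  have Psub: "P \<subseteq> carr" using subgroup.subset[OF P] .
  show "P \<subseteq> N_phi S P \<phi>"
  proof
    fix g assume g: "g \<in> P"
    have "g \<in> normS S P"
      using g Pc(1) subgroup_conjm[OF P] by (intro normSI subgroup_finite P Psub) auto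
    moreover have "\<phi> (conjm S g x) = conjm S (\<phi> g) (\<phi> x)" if "x \<in> P" for x
      using F_map(4)[OF P subgroup_self \<phi>] F_inv[OF P subgroup_self \<phi>] g that P
      by (simp add: conjm_def subgroup.m_closed subgroup.m_inv_closed)
    ultimately show "g \<in> N_phi S P \<phi>" unfolding iff using Pc(2)[OF g] by blast
  qed
  show "centS S P \<subseteq> N_phi S P \<phi>"
  proof
    fix g assume "g \<in> centS S P"
    then have g: "g \<in> carr" "\<And>x. x \<in> P \<Longrightarrow> g \<otimes> x = x \<otimes> g" by (auto simp: centS_def)
    have fixed: "conjm S g x = x" if "x \<in> P" for x
      using g Pc(1)[OF that] that by (simp add: conjm_def m_assoc)
    have "g \<in> normS S P"
      using g(1) fixed by (intro normSI subgroup_finite P Psub) auto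
    moreover have "\<phi> (conjm S g x) = conjm S \<one> (\<phi> x)" if "x \<in> P" for x
      using fixed that Pc(2) by simp
    ultimately show "g \<in> N_phi S P \<phi>" unfolding iff by blast
  qed
qed

text \<open>\<open>C\<^sub>S(P)\<close> cannot be smaller than \<open>Z(P)\<close>, and \<open>\<F>\<close>-conjugate subgroups have
  isomorphic centres.\<close>

lemma fully_centralized_centricI:
  assumes P: "fully_centralized S F P" and C: "centS S P \<subseteq> P"
  shows "F_centric S F P"
  unfolding F_centric_def
proof (intro conjI allI impI)
  show sP: "subgroup P S" using P by (simp add: fully_centralized_def)
  fix Q assume Q: "F_conj_sub S F P Q"
  then obtain \<phi> where \<phi>: "subgroup Q S" "\<phi> \<in> F P Q" "\<phi> ` P = Q" by (auto simp: F_conj_sub_iff)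
  note map = F_map[OF sP \<phi>(1,2)]
  have cf: "finite (centS S Q)" by (rule finite_subset[OF _ fin]) (auto simp: centS_def)
  have "\<phi> ` centS S P \<subseteq> centS S Q"
  proof
    fix y assume "y \<in> \<phi> ` centS S P"
    then obtain z where z: "z \<in> centS S P" "y = \<phi> z" by blast
    have zP: "z \<in> P" using z C by blast
    have "\<phi> z \<otimes> \<phi> x = \<phi> x \<otimes> \<phi> z" if "x \<in> P" for x
      using z(1) that map(4)[OF zP that] map(4)[OF that zP] by (simp add: centS_def)
    then show "y \<in> centS S Q"
      using z(2) \<phi>(3) map(2)[OF zP] subgroup.mem_carrier[OF \<phi>(1)] by (auto simp: centS_def)
  qed
  \<comment> \<open>Full centralization of \<open>P\<close> bounds the centralizer of its conjugate
    \<open>Q\<close> from above, and \<phi> is injective; the inclusion just shown becomes an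
    equality by counting.\<close>
  moreover have "card (centS S Q) \<le> card (\<phi> ` centS S P)"
    using P Q card_image[OF inj_on_subset[OF map(3) C]] by (simp add: fully_centralized_def)
  ultimately have "\<phi> ` centS S P = centS S Q" using card_seteq[OF cf] by blast
  then show "centS S Q \<subseteq> Q" using C \<phi>(3) by blast
qed

end

text \<open>The index of \<open>H\<close> is a power of \<open>p\<close> that \<open>p\<close> does
  not divide, so it is 1.\<close>

lemma sylow_of_p_group:
  fixes G (structure)
  assumes p: "Factorial_Ring.prime p" and G: "p_group p G" and H: "sylow_sub p G H"
  shows "H = carrier G"
proof -
  interpret group G using G by (simp add: p_group_def)
  have fin: "finite (carrier G)" and H': "subgroup H G" using G H by (auto simp: p_group_def sylow_sub_def)
  obtain k where k: "order G = p ^ k" using G by (auto simp: p_group_def order_def)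
  have lag: "card (rcosets H) * card H = order G" by (rule lagrange[OF H'])
  moreover have "card H > 0" using H' fin subgroup.finite_imp_card_positive by blast
  ultimately have "order G div card H = card (rcosets H)" by (metis nonzero_mult_div_cancel_right less_irrefl)
  then have "\<not> p dvd card (rcosets H)" using H by (simp add: sylow_sub_def)
  moreover have "card (rcosets H) dvd p ^ k" using lag k by (metis dvd_triv_left)
  then obtain i where "card (rcosets H) = p ^ i" using p divides_primepow_nat by blast
  ultimately have "card (rcosets H) = 1" by (cases i) auto
  then have "card H = card (carrier G)" using lag by (simp add: order_def)
  then show ?thesis using fin subgroup.subset[OF H'] card_subset_eq by blast
qed

section \<open>Saturated fusion systems and nilpotency criteria\<close>

locale saturated_fusion_system = finite_fusion_system +
  fixes p :: nat
  assumes p: "Factorial_Ring.prime p" and p_power: "\<exists>k. order S = p ^ k"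
    and sat: "saturated p S F"
begin

lemma elem_conj_imp_p_group:
  assumes conj: "\<And>a b. a \<in> carr \<Longrightarrow> b \<in> carr \<Longrightarrow> F_conj_elem S F a b \<Longrightarrow> S_conj_elem S a b"
    and P: "subgroup P S"
  shows "p_group p (autF S F P)"
proof -
  interpret A: group "autF S F P" by (rule autF_group[OF P])
  obtain k where k: "order S = p ^ k" using p_power by blast
  have Pc: "x \<in> carr" if "x \<in> P" for x using that subgroup.mem_carrier[OF P] by blast
  have "\<exists>k. card (carrier (autF S F P)) = p ^ k"
  proof (rule A.prime_power_orderI[OF autF_finite[OF P]])
    fix q :: nat and \<phi>
    assume q: "Factorial_Ring.prime q" "q \<noteq> p" and "\<phi> \<in> carrier (autF S F P)"
      and pow: "\<phi> [^]\<^bsub>autF S F P\<^esub> q = \<one>\<^bsub>autF S F P\<^esub>"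
    then have \<phi>: "\<phi> \<in> F P P" by (simp add: autF_def)
    note map = F_map[OF P P \<phi>]
    \<comment> \<open>Restricting \<phi> to the cyclic subgroup generated by \<open>x\<close> turns
      it into a witness of conjugacy of elements. The conjugating element may depend on
      \<open>x\<close>.\<close>
    have Sc: "\<exists>s\<in>carr. conjm S s x = \<phi> x" if x: "x \<in> P" for x
    proof -
      have g: "subgroup (generate S {x}) S" using Pc[OF x] by (intro generate_is_subgroup) auto
      have gP: "generate S {x} \<subseteq> P" using x by (intro generate_subgroup_incl P) auto
      have xg: "x \<in> generate S {x}" by (rule generate.incl) auto
      have "restrict \<phi> (generate S {x}) \<in> F (generate S {x}) carr"
        using F_carr[OF g P F_restrict[OF P P \<phi> g gP]] .
      then have "F_conj_elem S F x (\<phi> x)" unfolding F_conj_elem_def using xg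
        by (intro bexI[of _ "restrict \<phi> (generate S {x})"]) auto
      then show ?thesis using conj[OF Pc[OF x] Pc[OF map(2)[OF x]]] by (simp add: S_conj_elem_def)
    qed
    \<comment> \<open>The intersection is just \<open>P\<close>; in this form the claim is the last
      instance of a property of the terms \<open>M\<close> of the central series.\<close>
    have "\<forall>x\<in>P \<inter> carr. \<phi> x = x"
    proof (rule central_series_induct[OF p k fin])
      show "\<forall>x\<in>P \<inter> {\<one>}. \<phi> x = x" using F_one[OF P P \<phi>] by simp
      fix M assume M: "M \<lhd> S" and fixM: "\<forall>x\<in>P \<inter> M. \<phi> x = x"
      show "\<forall>x\<in>P \<inter> comm_into S M. \<phi> x = x"
      proof
        fix x assume "x \<in> P \<inter> comm_into S M"
        then have x: "x \<in> P" "x \<in> comm_into S M" by auto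
        obtain s where s: "s \<in> carr" "conjm S s x = \<phi> x" using Sc[OF x(1)] by blast
        \<comment> \<open>This defect equals the commutator \<open>[s,x]\<close>. It lies in
          \<open>M\<close>, because \<open>x\<close> is central modulo \<open>M\<close>, and in
          \<open>P\<close>, because \<phi> preserves \<open>P\<close>; so \<phi> fixes it by the
          induction hypothesis.\<close>
        define m where "m = \<phi> x \<otimes> inv x"
        have mM: "m \<in> M" using x(2) s by (auto simp: m_def comm_into_def conjm_def)
        have mP: "m \<in> P" using P x(1) map(2) by (simp add: m_def subgroup.m_closed subgroup.m_inv_closed)
        have c: "x \<in> carr" "m \<in> carr" "\<phi> x \<in> carr" using x(1) mP map(2) Pc by auto
        have mx: "\<phi> x = m \<otimes> x" using c by (simp add: m_def m_assoc)
        have "m [^] q \<otimes> x = x"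
          using autF_pow_fixed_defect[OF P \<phi> x(1) mP _ mx, of q] fixM mM mP pow x(1)
          by (simp add: autF_def)
        then have mq: "m [^] q = \<one>" using c by simp
        \<comment> \<open>The order of \<open>m\<close> divides the prime \<open>q\<close> and also
          a power of the different prime \<open>p\<close>, which leaves only order 1.\<close>
        have "ord m dvd q" using mq c by (simp add: pow_eq_id)
        moreover have "ord m dvd p ^ k" using ord_dvd_group_order[OF c(2)] k by simp
        moreover have "coprime q (p ^ k)" using q p by (simp add: primes_coprime)
        ultimately have "ord m = 1" by (meson coprime_common_divisor_nat nat_dvd_1_iff_1 coprime_def dvd_1_iff_1)
        then have "m = \<one>" using pow_ord_eq_1[OF c(2)] c(2) by simp
        then show "\<phi> x = x" using mx c by simp
      qed
    qed
    then show "\<phi> = \<one>\<^bsub>autF S F P\<^esub>"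
      using map(1) Pc by (auto simp: autF_def fun_eq_iff extensional_def)
  qed
  then show ?thesis using A.is_group autF_finite[OF P] by (simp add: p_group_def)
qed

lemma fully_normalized_D:
  assumes "fully_normalized S F R"
  shows "fully_centralized S F R" "sylow_sub p (autF S F R) (HomS S R R)"
  using sat assms by (auto simp: saturated_def)

text \<open>Saturation axiom (II) extends \<phi> to the strictly larger group
  \<open>N_phi S P \<phi>\<close>, where \<open>IH\<close> makes the extension conjugation by some
  \<open>s\<close>. The same \<open>s\<close> then serves on \<open>P\<close>.\<close>

lemma extend_and_conj:
  assumes P: "subgroup P S" and \<phi>: "\<phi> \<in> F P carr" and fc: "fully_centralized S F (\<phi> ` P)"
    and lt: "P \<subset> N_phi S P \<phi>"
    and IH: "\<And>Q \<psi>. subgroup Q S \<Longrightarrow> P \<subset> Q \<Longrightarrow> \<psi> \<in> F Q carr \<Longrightarrow> \<psi> \<in> HomS S Q carr"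
  shows "\<phi> \<in> HomS S P carr"
proof -
  have N: "subgroup (N_phi S P \<phi>) S" by (rule N_phi_subgroup[OF P \<phi>])
  obtain \<psi> where \<psi>: "\<psi> \<in> F (N_phi S P \<phi>) carr" "\<forall>x\<in>P. \<psi> x = \<phi> x"
    using sat P \<phi> fc unfolding saturated_def by blast
  obtain s where "s \<in> carr" "\<forall>x\<in>N_phi S P \<phi>. \<psi> x = conjm S s x"
    using IH[OF N lt \<psi>(1)] HomS_carr_iff[OF N] by blast
  then have "s \<in> carr" "\<forall>x\<in>P. \<phi> x = conjm S s x"
    using \<psi>(2) psubset_imp_subset[OF lt] by (metis subsetD)+
  then show ?thesis using HomS_carr_iff[OF P] F_map(1)[OF P subgroup_self \<phi>] by blast
qed

text \<open>If \<chi> is conjugation by \<open>t\<close> and the composite is conjugation by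
  \<open>s\<close>, then \<phi> is conjugation by \<open>t^-1 s\<close>.\<close>

lemma HomS_cancel:
  assumes P: "subgroup P S" and Q: "subgroup Q S" and \<phi>: "\<phi> \<in> F P Q"
    and \<chi>: "\<chi> \<in> HomS S Q carr" and c: "compose P \<chi> \<phi> \<in> HomS S P carr"
  shows "\<phi> \<in> HomS S P carr"
proof -
  obtain t where t: "t \<in> carr" "\<And>y. y \<in> Q \<Longrightarrow> \<chi> y = conjm S t y"
    using \<chi> HomS_carr_iff[OF Q] by blast
  obtain s where s: "s \<in> carr" "\<And>x. x \<in> P \<Longrightarrow> compose P \<chi> \<phi> x = conjm S s x"
    using c HomS_carr_iff[OF P] by blast
  have "\<phi> x = conjm S (inv t \<otimes> s) x" if x: "x \<in> P" for x
  proof -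
    have xc: "x \<in> carr" "\<phi> x \<in> Q" "\<phi> x \<in> carr"
      using x F_map(2)[OF P Q \<phi>] subgroup.mem_carrier[OF P] subgroup.mem_carrier[OF Q] by auto
    have "conjm S t (\<phi> x) = conjm S s x" using s(2)[OF x] t(2)[OF xc(2)] x by (simp add: compose_def)
    then have "\<phi> x = conjm S (inv t) (conjm S s x)" using xc t(1) by (metis conjm_inv_cancel(1))
    then show ?thesis using t(1) s(1) xc by (simp add: conjm_comp)
  qed
  then show ?thesis using HomS_carr_iff[OF P] F_map(1)[OF P Q \<phi>] s(1) t(1) by blast
qed

text \<open>The inductive step of Alperin's fusion theorem. Once \<open>Aut\<^sub>\<F>(R) = Aut\<^sub>S(R)\<close> for the fully
  normalized conjugate \<open>R\<close>, every isomorphism \<open>P \<rightarrow> R\<close> extends to \<open>N\<^sub>S(P)\<close>, so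
  no appeal to the conjugacy of Sylow subgroups is needed.\<close>

lemma centric_p_group_imp_HomS:
  assumes cen: "\<And>P. F_centric S F P \<Longrightarrow> p_group p (autF S F P)"
  assumes "subgroup P S" "\<phi> \<in> F P carr"
  shows "\<phi> \<in> HomS S P carr"
  using assms(2,3)
proof (induction "card carr - card P" arbitrary: P \<phi> rule: less_induct)
  case less
  note P = less.prems(1) and \<phi> = less.prems(2)
  \<comment> \<open>The induction depends on \<open>P\<close> only through its order, so the
    hypothesis also serves proper overgroups of the conjugates of \<open>P\<close>.\<close>
  have IH: "\<psi> \<in> HomS S T carr"
    if "card R = card P" "subgroup T S" "R \<subset> T" "\<psi> \<in> F T carr" for R T \<psi>
  proof (rule less.hyps[OF _ that(2,4)])
    have "card R < card T" "card T \<le> card carr"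
      using that psubset_card_mono[OF subgroup_finite] card_mono[OF fin] subgroup.subset by blast+
    then show "card carr - card T < card carr - card P" using that(1) by linarith
  qed
  obtain R where R: "F_conj_sub S F P R" "fully_normalized S F R"
    using fully_normalized_exists[OF P] .
  have sR: "subgroup R S" and cR: "card R = card P"
    using R(1) F_conj_sub_card[OF R(1)] by (simp_all add: F_conj_sub_def)
  have fcR: "fully_centralized S F R" using fully_normalized_D[OF R(2)] by blast
  have autR: "\<alpha> \<in> HomS S R carr" if \<alpha>: "\<alpha> \<in> F R R" for \<alpha>
  proof (cases "centS S R \<subseteq> R")
    case True
    then have "p_group p (autF S F R)" using fcR cen fully_centralized_centricI by blast
    then have "HomS S R R = F R R"
      using sylow_of_p_group[OF p _ fully_normalized_D(2)[OF R(2)]] by (simp add: autF_def)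
    then show ?thesis using \<alpha> HomS_iff[OF sR sR] by blast
  next
    case False
    have \<alpha>': "\<alpha> \<in> F R carr" by (rule F_carr[OF sR sR \<alpha>])
    \<comment> \<open>The domain contains \<open>R\<close> and its centralizer, and the latter now
      has elements outside \<open>R\<close>.\<close>
    have "R \<subset> N_phi S R \<alpha>" using N_phi_contains[OF sR \<alpha>'] False by blast
    then show ?thesis
      using extend_and_conj[OF sR \<alpha>'] IH[OF cR] fcR autF_image[OF sR \<alpha>] by simp
  qed
  have toR: "\<psi> \<in> HomS S Q carr" if Q: "subgroup Q S" "card Q = card P" and \<psi>: "\<psi> \<in> F Q R" "\<psi> ` Q = R" for Q \<psi>
  proof (cases "Q = carr")
    case True
    \<comment> \<open>No larger group is available to extend to, but \<open>R\<close> has the order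
      of \<open>S\<close>, so \<psi> is an automorphism of \<open>R\<close>.\<close>
    then have "R = carr" using sR cR Q(2) fin card_subset_eq subgroup.subset by metis
    then show ?thesis using True autR \<psi>(1) by simp
  next
    case False
    have \<psi>': "\<psi> \<in> F Q carr" by (rule F_carr[OF Q(1) sR \<psi>(1)])
    obtain \<psi>i where \<psi>i: "\<psi>i \<in> F R Q" "\<And>x. x \<in> Q \<Longrightarrow> \<psi>i (\<psi> x) = x"
      using F_inverse[OF Q(1) sR \<psi>] by metis
    \<comment> \<open>Transporting conjugation by \<open>g\<close> along \<psi> gives an
      automorphism of \<open>R\<close>, hence conjugation by some \<open>t\<close>, the partner of
      \<open>g\<close>. Since normalizers grow in p-groups, the extension domain strictly contains
      \<open>Q\<close>.\<close>
    have "normS S Q \<subseteq> N_phi S Q \<psi>"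
    proof
      fix g assume g: "g \<in> normS S Q"
      then have gc: "g \<in> carr" and gQ: "conjm S g ` Q \<subseteq> Q" by (auto simp: normS_def)
      have cg: "restrict (conjm S g) Q \<in> F Q Q"
        using gc gQ by (intro HomS_F Q) (auto simp: HomS_def)
      have "compose R \<psi> (compose R (restrict (conjm S g) Q) \<psi>i) \<in> F R R"
        using F_compose[OF sR Q(1) sR F_compose[OF sR Q(1) Q(1) \<psi>i(1) cg] \<psi>(1)] .
      then obtain t where t: "t \<in> carr"
        "\<And>y. y \<in> R \<Longrightarrow> compose R \<psi> (compose R (restrict (conjm S g) Q) \<psi>i) y = conjm S t y"
        using autR HomS_carr_iff[OF sR] by blast
      have "\<psi> (conjm S g x) = conjm S t (\<psi> x)" if "x \<in> Q" for x
        using t(2)[of "\<psi> x"] that \<psi>(2) \<psi>i(2)[OF that] by (auto simp: compose_def)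
      then show "g \<in> N_phi S Q \<psi>" unfolding N_phi_iff[OF Q(1) \<psi>'] using g t(1) by blast
    qed
    moreover obtain k where "order S = p ^ k" using p_power by blast
    then have "Q \<subset> normS S Q"
      using prime_power_normalizer_grows[OF p _ fin Q(1) False] by blast
    ultimately have "Q \<subset> N_phi S Q \<psi>" by blast
    then show ?thesis
      using extend_and_conj[OF Q(1) \<psi>'] IH[OF Q(2)] fcR \<psi>(2) by simp
  qed
  \<comment> \<open>It remains to pass from isomorphisms onto \<open>R\<close> to the arbitrary
    \<phi>. For an isomorphism \<chi> from the image \<open>Q\<close> to \<open>R\<close>, both
    \<chi> and its composite with \<phi> are conjugations, and \<chi> can be cancelled.\<close>
  define Q where "Q = \<phi> ` P"
  have Q: "subgroup Q S" unfolding Q_def by (rule F_image_subgroup[OF P subgroup_self \<phi>])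
  have \<phi>Q: "\<phi> \<in> F P Q" using F_codomain[OF P subgroup_self \<phi> Q] by (simp add: Q_def)
  have PQ: "F_conj_sub S F P Q" using P Q \<phi>Q by (auto simp: F_conj_sub_iff Q_def)
  have "F_conj_sub S F Q R" using F_conj_sub_trans[OF F_conj_sub_sym[OF PQ] R(1)] .
  then obtain \<chi> where \<chi>: "\<chi> \<in> F Q R" "\<chi> ` Q = R" by (auto simp: F_conj_sub_iff)
  have "compose P \<chi> \<phi> ` P = R" using \<chi>(2) by (auto simp: compose_def Q_def)
  then have "compose P \<chi> \<phi> \<in> HomS S P carr"
    using toR[OF P refl F_compose[OF P Q sR \<phi>Q \<chi>(1)]] by blast
  moreover have "\<chi> \<in> HomS S Q carr"
    using toR[OF Q _ \<chi>] F_conj_sub_card[OF PQ] by simp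
  ultimately show ?case using HomS_cancel[OF P Q \<phi>Q] by blast
qed

section \<open>Nilpotency and conjugacy of tuples\<close>

lemma nilpotentI:
  assumes "\<And>P \<phi>. subgroup P S \<Longrightarrow> \<phi> \<in> F P carr \<Longrightarrow> \<phi> \<in> HomS S P carr"
  shows "nilpotent_plfg S F"
  unfolding nilpotent_plfg_def
proof (intro allI impI equalityI subsetI)
  fix P Q \<phi> assume PQ: "subgroup P S \<and> subgroup Q S"
  then have P: "subgroup P S" and Q: "subgroup Q S" by auto
  show "\<phi> \<in> F P Q" if "\<phi> \<in> HomS S P Q" using HomS_F[OF P Q that] .
  show "\<phi> \<in> HomS S P Q" if \<phi>: "\<phi> \<in> F P Q"
    using assms[OF P F_carr[OF P Q \<phi>]] F_map(2)[OF P Q \<phi>] HomS_iff[OF P Q] by blast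
qed

text \<open>A constant tuple of positive length has the one-element entry set \<open>{a}\<close>, so
  it generates the same cyclic subgroup as \<open>a\<close>. This carries condition (2), for any
  \<open>n\<close>, back to condition (1).\<close>

lemma F_conj_tuple_replicate:
  assumes "n > 0"
  shows "F_conj_tuple S F n (replicate n a) (replicate n b) \<longleftrightarrow> F_conj_elem S F a b"
  using assms by (auto simp: F_conj_tuple_def F_conj_elem_def set_replicate)

lemma S_conj_tuple_replicate:
  assumes "n > 0"
  shows "S_conj_tuple S n (replicate n a) (replicate n b) \<longleftrightarrow> S_conj_elem S a b"
  using assms by (auto simp: S_conj_tuple_def S_conj_elem_def)

text \<open>Morphisms on the subgroup generated by the tuple are exactly restrictions of
  conjugations by elements of \<open>S\<close>, and the entries of the tuple lie in that
  subgroup.\<close>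

lemma nilpotent_F_conj_tuple_iff:
  assumes nil: "nilpotent_plfg S F" and as: "length as = n" "set as \<subseteq> carr"
  shows "F_conj_tuple S F n as bs \<longleftrightarrow> S_conj_tuple S n as bs"
proof -
  let ?P = "generate S (set as)"
  have P: "subgroup ?P S" using as(2) by (rule generate_is_subgroup)
  have F: "F ?P carr = HomS S ?P carr" using nil P by (simp add: nilpotent_plfg_def)
  have el: "as ! i \<in> ?P" if "i < n" for i using that as(1) by (auto intro: generate.incl)
  show ?thesis
  proof
    assume "F_conj_tuple S F n as bs"
    then obtain \<phi> where "\<phi> \<in> HomS S ?P carr" "\<forall>i<n. \<phi> (as ! i) = bs ! i"
      using F by (auto simp: F_conj_tuple_def)
    then show "S_conj_tuple S n as bs"
      using el HomS_carr_iff[OF P] unfolding S_conj_tuple_def by metis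
  next
    assume "S_conj_tuple S n as bs"
    then obtain s where s: "s \<in> carr" "\<forall>i<n. conjm S s (as ! i) = bs ! i"
      by (auto simp: S_conj_tuple_def)
    have "restrict (conjm S s) ?P \<in> HomS S ?P carr" unfolding HomS_carr_iff[OF P] using s(1) by auto
    then show "F_conj_tuple S F n as bs"
      unfolding F_conj_tuple_def F using s(2) el
      by (intro bexI[of _ "restrict (conjm S s) ?P"]) auto
  qed
qed

end

theorem theorem4p8:
  fixes p :: nat and S :: "('a, 'b) monoid_scheme"
    and F :: "'a set \<Rightarrow> 'a set \<Rightarrow> ('a \<Rightarrow> 'a) set"
    and L :: "('a, 'm, 'e) lsys_scheme"
  assumes "p_local_finite_group p S F L"
  shows "(nilpotent_plfg S F \<longleftrightarrow>
            (\<forall>a\<in>carrier S. \<forall>b\<in>carrier S. F_conj_elem S F a b \<longleftrightarrow> S_conj_elem S a b))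
       \<and> (nilpotent_plfg S F \<longleftrightarrow>
            (\<exists>n::nat. n > 1 \<and> (\<forall>as bs. commuting_tuple S n as \<and> commuting_tuple S n bs \<longrightarrow>
               (F_conj_tuple S F n as bs \<longleftrightarrow> S_conj_tuple S n as bs))))
       \<and> (nilpotent_plfg S F \<longleftrightarrow>
            (\<forall>P. subgroup P S \<longrightarrow> p_group p (autF S F P)))
       \<and> (nilpotent_plfg S F \<longleftrightarrow>
            (\<forall>P. F_centric S F P \<longrightarrow> p_group p (autF S F P)))"
proof -
  have h: "Factorial_Ring.prime p" "group S" "finite (carrier S)" "\<exists>k. order S = p ^ k" "saturated p S F"
    using assms by (auto simp: p_local_finite_group_def finite_p_group_def)
  then have fs: "fusion_system S F" by (simp add: saturated_def)
  interpret saturated_fusion_system S F p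
    using h fs
    by (intro saturated_fusion_system.intro finite_fusion_system.intro
        finite_fusion_system_axioms.intro saturated_fusion_system_axioms.intro) auto
  let ?nil = "nilpotent_plfg S F"
  let ?c1 = "\<forall>a\<in>carrier S. \<forall>b\<in>carrier S. F_conj_elem S F a b \<longleftrightarrow> S_conj_elem S a b"
  let ?c2 = "\<lambda>n. \<forall>as bs. commuting_tuple S n as \<and> commuting_tuple S n bs \<longrightarrow>
               (F_conj_tuple S F n as bs \<longleftrightarrow> S_conj_tuple S n as bs)"
  let ?c3 = "\<forall>P. subgroup P S \<longrightarrow> p_group p (autF S F P)"
  let ?c4 = "\<forall>P. F_centric S F P \<longrightarrow> p_group p (autF S F P)"
  \<comment> \<open>Length 2 is the chosen witness for the existential in condition (2).\<close>
  have n2: "?c2 2" if "?nil"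
    using nilpotent_F_conj_tuple_iff[OF that] by (simp add: commuting_tuple_def)
  have i21: "?c1" if "n > 1" "?c2 n" for n
  proof (intro ballI)
    fix a b assume "a \<in> carrier S" "b \<in> carrier S"
    then have "commuting_tuple S n (replicate n a)" "commuting_tuple S n (replicate n b)"
      using that(1) by (auto simp: commuting_tuple_def)
    then have "F_conj_tuple S F n (replicate n a) (replicate n b) \<longleftrightarrow>
        S_conj_tuple S n (replicate n a) (replicate n b)" using that(2) by blast
    then show "F_conj_elem S F a b \<longleftrightarrow> S_conj_elem S a b"
      using that(1) by (simp add: F_conj_tuple_replicate S_conj_tuple_replicate)
  qed
  have i13: "?c3" if "?c1" using elem_conj_imp_p_group that by blast
  have i34: "?c4" if "?c3" using that by (simp add: F_centric_def)
  have i4n: "?nil" if "?c4" using nilpotentI centric_p_group_imp_HomS that by blast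
  have "(1::nat) < 2" by simp
  \<comment> \<open>The implications form the cycle nilpotent, (2), (1), (3), (4), nilpotent. The
    existential in (2) is entered at \<open>n = 2\<close> and left at an arbitrary
    \<open>n > 1\<close>.\<close>
  then have "?nil \<longleftrightarrow> (\<exists>n>1. ?c2 n)" using n2 i21 i13 i34 i4n by blast
  moreover have n1: "?c1" if "?nil" using i21[of 2] n2[OF that] by simp
  moreover have "?nil \<longleftrightarrow> ?c3" "?nil \<longleftrightarrow> ?c4" "?nil \<longleftrightarrow> ?c1" using n1 i13 i34 i4n by blast+
  ultimately show ?thesis by blast
qed

end
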